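(* Let $S$ be a BC Stein AG-groupoid. Then $S$ is a semigroup (i.e. $(ab)c=a(bc)$ for all $a,b,c\in S$) if any one of the following holds: (i) $S$ is an AG$^{*}$-groupoid; (ii) $S$ is an AG-3-band; (iii) $S$ is a $T^{4}$-AG-groupoid; (iv) $S$ has a cancellative element.
   Context: A groupoid is a set with a binary operation, written as juxtaposition. An AG-groupoid is a groupoid $S$ satisfying the left invertive law $(ab)c=(cb)a$ for all $a,b,c\in S$. A BC Stein AG-groupoid is an AG-groupoid $S$ satisfying $a(bc)=(bc)a$ for all $a,b,c\in S$. An AG-groupoid $S$ is called: an AG$^{*}$-groupoid if $(ab)c=b(ac)$ for all $a,b,c\in S$; an AG-3-band if $a(aa)=a$ for all $a\in S$; a $T_{f}^{4}$-AG-groupoid if, for all $a,b,c,d\in S$, $ab=cd$ implies $ad=cb$; a $T_{b}^{4}$-AG-groupoid if, for all $a,b,c,d\in S$, $ab=cd$ implies $da=bc$; a $T^{4}$-AG-groupoid if it is both a $T_{f}^{4}$- and a $T_{b}^{4}$-AG-groupoid. An element $x\in S$ is left cancellative if $xa=xb$ implies $a=b$ for all $a,b\in S$, right cancellative if $ax=bx$ implies $a=b$ for all $a,b\in S$, and cancellative if it is both left and right cancellative. *)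

theory Defs
  imports Main
begin

text \<open>
  All structures are relative to a carrier set, so that they range over arbitrary sets
  (including the empty one) closed under the operation. ``Groupoid'' means magma here.
\<close>

locale groupoid =
  fixes S :: "'a set" and mult :: "'a \<Rightarrow> 'a \<Rightarrow> 'a" (infixl "\<cdot>" 70)
  assumes closed: "a \<in> S \<Longrightarrow> b \<in> S \<Longrightarrow> a \<cdot> b \<in> S"

locale carrier_semigroup = groupoid +
  assumes assoc: "a \<in> S \<Longrightarrow> b \<in> S \<Longrightarrow> c \<in> S \<Longrightarrow> (a \<cdot> b) \<cdot> c = a \<cdot> (b \<cdot> c)"

locale ag_groupoid = groupoid +
  assumes left_invertive: "a \<in> S \<Longrightarrow> b \<in> S \<Longrightarrow> c \<in> S \<Longrightarrow> (a \<cdot> b) \<cdot> c = (c \<cdot> b) \<cdot> a"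

locale bc_stein_ag_groupoid = ag_groupoid +
  assumes bc_stein: "a \<in> S \<Longrightarrow> b \<in> S \<Longrightarrow> c \<in> S \<Longrightarrow> a \<cdot> (b \<cdot> c) = (b \<cdot> c) \<cdot> a"

locale ag_star_groupoid = ag_groupoid +
  assumes ag_star: "a \<in> S \<Longrightarrow> b \<in> S \<Longrightarrow> c \<in> S \<Longrightarrow> (a \<cdot> b) \<cdot> c = b \<cdot> (a \<cdot> c)"

locale ag_3_band = ag_groupoid +
  assumes three_band: "a \<in> S \<Longrightarrow> a \<cdot> (a \<cdot> a) = a"

locale t4f_ag_groupoid = ag_groupoid +
  assumes t4f: "a \<in> S \<Longrightarrow> b \<in> S \<Longrightarrow> c \<in> S \<Longrightarrow> d \<in> S \<Longrightarrow> a \<cdot> b = c \<cdot> d \<Longrightarrow> a \<cdot> d = c \<cdot> b"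

locale t4b_ag_groupoid = ag_groupoid +
  assumes t4b: "a \<in> S \<Longrightarrow> b \<in> S \<Longrightarrow> c \<in> S \<Longrightarrow> d \<in> S \<Longrightarrow> a \<cdot> b = c \<cdot> d \<Longrightarrow> d \<cdot> a = b \<cdot> c"

locale t4_ag_groupoid = t4f_ag_groupoid + t4b_ag_groupoid

definition left_cancellative :: "'a set \<Rightarrow> ('a \<Rightarrow> 'a \<Rightarrow> 'a) \<Rightarrow> 'a \<Rightarrow> bool" where
  "left_cancellative S mult x \<longleftrightarrow> (\<forall>a\<in>S. \<forall>b\<in>S. mult x a = mult x b \<longrightarrow> a = b)"

definition right_cancellative :: "'a set \<Rightarrow> ('a \<Rightarrow> 'a \<Rightarrow> 'a) \<Rightarrow> 'a \<Rightarrow> bool" where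
  "right_cancellative S mult x \<longleftrightarrow> (\<forall>a\<in>S. \<forall>b\<in>S. mult a x = mult b x \<longrightarrow> a = b)"

definition cancellative :: "'a set \<Rightarrow> ('a \<Rightarrow> 'a \<Rightarrow> 'a) \<Rightarrow> 'a \<Rightarrow> bool" where
  "cancellative S mult x \<longleftrightarrow> left_cancellative S mult x \<and> right_cancellative S mult x"

end

theory Submission
  imports Defs
begin

text \<open>
  In a BC Stein AG-groupoid every product commutes with every element, and
  $a(bc) = (ac)b$. Hence associativity amounts to $(ab)c = (ac)b$, which is immediate from
  AG$^*$ and also from commutativity. In an AG-3-band every element $a = a(aa)$ is a product, and
  in a $T^4$-AG-groupoid $a(bc) = (bc)a$ forces $aa = (bc)(bc)$, so all squares coincide and
  $aa = bb$ yields $ab = ba$. Finally, $x((ab)c) = (ax)(bc)$ is always symmetric in $b$ and $c$,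
  so a left cancellative $x$ suffices.
\<close>

context ag_groupoid
begin

text \<open>The medial law of AG-groupoids: the left invertive law is applied to the whole product,
  then inside its left factor, then to the whole again.\<close>

lemma medial:
  assumes "a \<in> S" "b \<in> S" "c \<in> S" "d \<in> S"
  shows "(a \<cdot> b) \<cdot> (c \<cdot> d) = (a \<cdot> c) \<cdot> (b \<cdot> d)"
proof -
  have "(a \<cdot> b) \<cdot> (c \<cdot> d) = ((c \<cdot> d) \<cdot> b) \<cdot> a"
    using assms by (intro left_invertive closed)
  also have "(c \<cdot> d) \<cdot> b = (b \<cdot> d) \<cdot> c"
    using assms by (intro left_invertive)
  also have "((b \<cdot> d) \<cdot> c) \<cdot> a = (a \<cdot> c) \<cdot> (b \<cdot> d)"
    using assms by (intro left_invertive closed)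
  finally show ?thesis .
qed

end

lemma (in t4f_ag_groupoid) commutes_imp_squares_eq:
  assumes "a \<in> S" "b \<in> S" "a \<cdot> b = b \<cdot> a"
  shows "a \<cdot> a = b \<cdot> b"
  using t4f[of a b b a] assms by simp

context bc_stein_ag_groupoid
begin

lemma mult_right_eq:
  assumes "a \<in> S" "b \<in> S" "c \<in> S"
  shows "a \<cdot> (b \<cdot> c) = (a \<cdot> c) \<cdot> b"
  using assms bc_stein left_invertive by metis

text \<open>Both sides equal (ac)b, the first by \<open>mult_right_eq\<close> and the second by
  \<open>bc_stein\<close>.\<close>

lemma left_commute:
  assumes "a \<in> S" "b \<in> S" "c \<in> S"
  shows "a \<cdot> (b \<cdot> c) = b \<cdot> (a \<cdot> c)"
  using assms mult_right_eq bc_stein by (metis closed)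

lemma carrier_semigroupI:
  assumes "\<And>a b c. a \<in> S \<Longrightarrow> b \<in> S \<Longrightarrow> c \<in> S \<Longrightarrow> (a \<cdot> b) \<cdot> c = (a \<cdot> c) \<cdot> b"
  shows "carrier_semigroup S (\<cdot>)"
  by unfold_locales (simp add: assms mult_right_eq)

lemma carrier_semigroup_if_commutative:
  assumes comm: "\<And>a b. a \<in> S \<Longrightarrow> b \<in> S \<Longrightarrow> a \<cdot> b = b \<cdot> a"
  shows "carrier_semigroup S (\<cdot>)"
proof (rule carrier_semigroupI)
  fix a b c assume "a \<in> S" "b \<in> S" "c \<in> S"
  then show "(a \<cdot> b) \<cdot> c = (a \<cdot> c) \<cdot> b"
    \<comment> \<open>(ab)c = (ba)c = (ca)b = (ac)b.\<close>
    using comm left_invertive by metis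
qed

text \<open>Being a product, ax commutes with everything, so it can be moved to the innermost right
  place, where \<open>left_commute\<close> exchanges b and c.\<close>

lemma product_mult_commute:
  assumes "a \<in> S" "x \<in> S" "b \<in> S" "c \<in> S"
  shows "(a \<cdot> x) \<cdot> (b \<cdot> c) = (a \<cdot> x) \<cdot> (c \<cdot> b)"
proof -
  have "(a \<cdot> x) \<cdot> (b \<cdot> c) = b \<cdot> ((a \<cdot> x) \<cdot> c)"
    using assms by (intro left_commute closed)
  also have "(a \<cdot> x) \<cdot> c = c \<cdot> (a \<cdot> x)"
    using assms by (simp add: bc_stein)
  also have "b \<cdot> (c \<cdot> (a \<cdot> x)) = c \<cdot> (b \<cdot> (a \<cdot> x))"
    using assms by (intro left_commute closed)
  also have "b \<cdot> (a \<cdot> x) = (a \<cdot> x) \<cdot> b"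
    using assms by (intro bc_stein)
  also have "c \<cdot> ((a \<cdot> x) \<cdot> b) = (a \<cdot> x) \<cdot> (c \<cdot> b)"
    using assms by (intro left_commute closed)
  finally show ?thesis .
qed

text \<open>x((ab)c) = (ab)(xc) = (ax)(bc): \<open>medial\<close> gathers b and c in one factor,
  ready for \<open>product_mult_commute\<close>.\<close>

lemma mult_triple_eq:
  assumes "x \<in> S" "a \<in> S" "b \<in> S" "c \<in> S"
  shows "x \<cdot> ((a \<cdot> b) \<cdot> c) = (a \<cdot> x) \<cdot> (b \<cdot> c)"
  using assms left_commute[of x "a \<cdot> b" c] medial[of a b x c] by (simp add: closed)

lemma carrier_semigroup_if_left_cancellative:
  assumes "x \<in> S" "left_cancellative S (\<cdot>) x"
  shows "carrier_semigroup S (\<cdot>)"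
proof (rule carrier_semigroupI)
  fix a b c assume abc: "a \<in> S" "b \<in> S" "c \<in> S"
  then have "x \<cdot> ((a \<cdot> b) \<cdot> c) = x \<cdot> ((a \<cdot> c) \<cdot> b)"
    using \<open>x \<in> S\<close> by (simp add: mult_triple_eq product_mult_commute)
  then show "(a \<cdot> b) \<cdot> c = (a \<cdot> c) \<cdot> b"
    using assms abc by (simp add: left_cancellative_def closed)
qed

lemma carrier_semigroup_if_ag_star:
  assumes "ag_star_groupoid S (\<cdot>)"
  shows "carrier_semigroup S (\<cdot>)"
proof (rule carrier_semigroupI)
  fix a b c assume "a \<in> S" "b \<in> S" "c \<in> S"
  then show "(a \<cdot> b) \<cdot> c = (a \<cdot> c) \<cdot> b"
    \<comment> \<open>(ab)c = b(ac) = (ac)b.\<close>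
    using ag_star_groupoid.ag_star[OF assms] bc_stein by simp
qed

lemma carrier_semigroup_if_ag_3_band:
  assumes "ag_3_band S (\<cdot>)"
  shows "carrier_semigroup S (\<cdot>)"
proof (rule carrier_semigroup_if_commutative)
  fix a b assume "a \<in> S" "b \<in> S"
  then show "a \<cdot> b = b \<cdot> a"
    using ag_3_band.three_band[OF assms, of b] bc_stein[of a b "b \<cdot> b"] by (simp add: closed)
qed

lemma carrier_semigroup_if_t4f:
  assumes "t4f_ag_groupoid S (\<cdot>)"
  shows "carrier_semigroup S (\<cdot>)"
proof -
  interpret t4f_ag_groupoid S "(\<cdot>)" by fact
  show ?thesis
  proof (rule carrier_semigroup_if_commutative)
    fix a b assume ab: "a \<in> S" "b \<in> S"
    \<comment> \<open>The product aa commutes with both a and b, so its square links aa and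
      bb.\<close>
    have "a \<cdot> a = (a \<cdot> a) \<cdot> (a \<cdot> a)" "b \<cdot> b = (a \<cdot> a) \<cdot> (a \<cdot> a)"
      using ab by (auto intro!: commutes_imp_squares_eq bc_stein closed)
    then have "a \<cdot> a = b \<cdot> b" by simp
    then show "a \<cdot> b = b \<cdot> a" using ab t4f by blast
  qed
qed

end

theorem theorem1:
  fixes S :: "'a set" and mult :: "'a \<Rightarrow> 'a \<Rightarrow> 'a"
  assumes "bc_stein_ag_groupoid S mult"
    and "ag_star_groupoid S mult \<or> ag_3_band S mult \<or> t4_ag_groupoid S mult
      \<or> (\<exists>x\<in>S. cancellative S mult x)"
  shows "carrier_semigroup S mult"
proof -
  interpret bc_stein_ag_groupoid S mult by fact
  show ?thesis
    using assms(2) carrier_semigroup_if_ag_star carrier_semigroup_if_ag_3_band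
      carrier_semigroup_if_t4f carrier_semigroup_if_left_cancellative
    by (auto simp: cancellative_def t4_ag_groupoid_def)
qed

end
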